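(* If $R,S$ are $\Delta^0_2$ equivalence relations on $\omega$ that are mutually dark, then $R$ and $S$ have no supremum in the $\Delta^0_2$ equivalence relations; i.e., there is no $\Delta^0_2$ equivalence relation $T$ with $R\leq_c T$, $S\leq_c T$, and $T\leq_c U$ for every $\Delta^0_2$ equivalence relation $U$ with $R\leq_c U$ and $S\leq_c U$.
   Context: $R\leq_c S$ means there is a total computable $f$ with $x\mathrel{R}y\Leftrightarrow f(x)\mathrel{S}f(y)$. Equivalence relations are identified with subsets of $\omega$ via a computable pairing function. For $A\subseteq\omega$, $R$ is $A$-dark if $R$ has infinitely many classes and there is no infinite $A$-c.e. set $W$ with $u\not\mathrel{R}v$ for all distinct $u,v\in W$. $R,S$ are mutually dark if $R$ is $S$-dark and $S$ is $R$-dark. *)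

theory Defs
  imports Main "HOL-Library.Nat_Bijection"
begin

text \<open>
  Partial functions on \<open>\<omega>\<close> are of type \<^typ>\<open>nat \<rightharpoonup> nat\<close>; several arguments are
  coded into one by the computable pairing function \<^const>\<open>prod_encode\<close>.
\<close>

abbreviation pair :: "nat \<Rightarrow> nat \<Rightarrow> nat" where
  "pair x y \<equiv> prod_encode (x, y)"

text \<open>
  Kleene's schema of primitive recursion:
  \<open>h(a,0) = f(a)\<close> and \<open>h(a,n+1) = g(a,(n,h(a,n)))\<close>.
\<close>

definition prim_recursion :: "(nat \<rightharpoonup> nat) \<Rightarrow> (nat \<rightharpoonup> nat) \<Rightarrow> (nat \<rightharpoonup> nat)" where
  "prim_recursion f g = (\<lambda>x. case prod_decode x of (a, n) \<Rightarrow>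
     rec_nat (f a) (\<lambda>m r. Option.bind r (\<lambda>v. g (pair a (pair m v)))) n)"

text \<open>
  Unbounded minimisation; the search diverges if it meets an undefined value
  before the first zero.
\<close>

definition minimisation :: "(nat \<rightharpoonup> nat) \<Rightarrow> (nat \<rightharpoonup> nat)" where
  "minimisation f = (\<lambda>a.
     if \<exists>n. f (pair a n) = Some 0 \<and> (\<forall>m<n. f (pair a m) \<noteq> None)
     then Some (LEAST n. f (pair a n) = Some 0) else None)"

text \<open>
  The functions partial recursive in a set \<open>\<F>\<close> of given functions. For
  \<open>\<F> = {}\<close> these are the partial recursive functions.
\<close>

inductive recursive_in :: "(nat \<rightharpoonup> nat) set \<Rightarrow> (nat \<rightharpoonup> nat) \<Rightarrow> bool"
  for \<F> :: "(nat \<rightharpoonup> nat) set"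
where
  zero: "recursive_in \<F> (\<lambda>_. Some 0)"
| succ: "recursive_in \<F> (\<lambda>x. Some (Suc x))"
| left: "recursive_in \<F> (\<lambda>x. Some (fst (prod_decode x)))"
| right: "recursive_in \<F> (\<lambda>x. Some (snd (prod_decode x)))"
| oracle_call: "f \<in> \<F> \<Longrightarrow> recursive_in \<F> f"
| pairing: "recursive_in \<F> f \<Longrightarrow> recursive_in \<F> g \<Longrightarrow>
    recursive_in \<F> (\<lambda>x. Option.bind (f x) (\<lambda>u. Option.bind (g x) (\<lambda>v. Some (pair u v))))"
| composition: "recursive_in \<F> f \<Longrightarrow> recursive_in \<F> g \<Longrightarrow>
    recursive_in \<F> (\<lambda>x. Option.bind (g x) f)"
| prim_rec: "recursive_in \<F> f \<Longrightarrow> recursive_in \<F> g \<Longrightarrow>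
    recursive_in \<F> (prim_recursion f g)"
| minimise: "recursive_in \<F> f \<Longrightarrow> recursive_in \<F> (minimisation f)"

definition computable :: "(nat \<Rightarrow> nat) \<Rightarrow> bool" where
  "computable f \<longleftrightarrow> recursive_in {} (\<lambda>x. Some (f x))"

definition char_fun :: "nat set \<Rightarrow> nat \<Rightarrow> nat" where
  "char_fun A x = (if x \<in> A then 1 else 0)"

definition ce_in :: "nat set \<Rightarrow> nat set \<Rightarrow> bool" where
  "ce_in A W \<longleftrightarrow> (\<exists>f. recursive_in {\<lambda>x. Some (char_fun A x)} f \<and> W = dom f)"

text \<open>
  The arithmetical hierarchy. In the successor case \<open>- B\<close> ranges over the
  \<open>\<Pi>\<close>-sets of the level below.
\<close>

primrec Sigma0 :: "nat \<Rightarrow> nat set set" where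
  "Sigma0 0 = {A. computable (char_fun A)}"
| "Sigma0 (Suc n) = {{x. \<exists>y. pair x y \<in> - B} | B. B \<in> Sigma0 n}"

definition Pi0 :: "nat \<Rightarrow> nat set set" where
  "Pi0 n = {- A | A. A \<in> Sigma0 n}"

definition Delta0 :: "nat \<Rightarrow> nat set set" where
  "Delta0 n = Sigma0 n \<inter> Pi0 n"

definition rel_code :: "nat rel \<Rightarrow> nat set" where
  "rel_code R = prod_encode ` R"

definition Delta02_equiv :: "nat rel \<Rightarrow> bool" where
  "Delta02_equiv R \<longleftrightarrow> equiv UNIV R \<and> rel_code R \<in> Delta0 2"

definition reducible :: "nat rel \<Rightarrow> nat rel \<Rightarrow> bool"  (infix "\<le>\<^sub>c" 50) where
  "R \<le>\<^sub>c S \<longleftrightarrow> (\<exists>f. computable f \<and> (\<forall>x y. (x, y) \<in> R \<longleftrightarrow> (f x, f y) \<in> S))"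

definition dark :: "nat set \<Rightarrow> nat rel \<Rightarrow> bool" where
  "dark A R \<longleftrightarrow> infinite (UNIV // R) \<and>
     \<not> (\<exists>W. infinite W \<and> ce_in A W \<and> (\<forall>u\<in>W. \<forall>v\<in>W. u \<noteq> v \<longrightarrow> (u, v) \<notin> R))"

definition mutually_dark :: "nat rel \<Rightarrow> nat rel \<Rightarrow> bool" where
  "mutually_dark R S \<longleftrightarrow> dark (rel_code S) R \<and> dark (rel_code R) S"

end

theory Submission
  imports Defs "HOL-Library.Infinite_Set"
begin

text \<open>
  Number the classes of \<open>R\<close> and of \<open>S\<close> by their least elements, and let \<open>U\<close> be the quotient of
  \<open>R \<oplus> S\<close> in which the \<open>n\<close>-th class of \<open>R\<close> is glued to the \<open>n\<close>-th class of \<open>S\<close>, for every \<open>n\<close>.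
  Both \<open>U\<close> and \<open>R \<oplus> S\<close> are \<open>\<Delta>\<^sup>0\<^sub>2\<close> upper bounds of \<open>R\<close> and \<open>S\<close>, so a supremum \<open>T\<close>, with reductions
  \<open>f\<close> of \<open>R\<close> and \<open>g\<close> of \<open>S\<close> to \<open>T\<close>, reduces to both.

  As \<open>R\<close> is \<open>S\<close>-dark, a reduction of \<open>R\<close> to \<open>U\<close> or to \<open>R \<oplus> S\<close> sends all but finitely many classes
  to the \<open>R\<close>-side; likewise for \<open>S\<close>. As a dark relation has no self-reduction that misses a class,
  the resulting reduction of \<open>R\<close> to \<open>U\<close> hits almost every class of \<open>U\<close>, and so does that of \<open>S\<close>.
  Hence infinitely many classes of \<open>U\<close> are hit by both, that is, \<open>f x\<close> and \<open>g y\<close> are \<open>T\<close>-equivalent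
  for infinitely many inequivalent \<open>x\<close>. But in \<open>R \<oplus> S\<close> almost all images of \<open>R\<close> and \<open>S\<close> lie on
  different sides.
\<close>

section \<open>Classes of functions closed under primitive recursion\<close>

text \<open>The closure proofs below serve three times: for total functions recursive in an oracle,
  for computable functions and for limit-computable ones.\<close>

locale prim_rec_closed =
  fixes P :: "(nat \<Rightarrow> nat) \<Rightarrow> bool"
  assumes zero: "P (\<lambda>_. 0)"
    and succ: "P Suc"
    and left: "P (\<lambda>x. fst (prod_decode x))"
    and right: "P (\<lambda>x. snd (prod_decode x))"
    and pairing: "P f \<Longrightarrow> P g \<Longrightarrow> P (\<lambda>x. pair (f x) (g x))"
    and composition: "P f \<Longrightarrow> P g \<Longrightarrow> P (\<lambda>x. f (g x))"
    and recursion: "P f \<Longrightarrow> P g \<Longrightarrow>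
      P (\<lambda>x. rec_nat (f (fst (prod_decode x)))
        (\<lambda>m r. g (pair (fst (prod_decode x)) (pair m r))) (snd (prod_decode x)))"
begin

lemma closed_id: "P (\<lambda>x. x)"
  using pairing[OF left right] by simp

lemma closed_Suc: "P f \<Longrightarrow> P (\<lambda>x. Suc (f x))"
  using composition[OF succ] .

lemma closed_fst: "P f \<Longrightarrow> P (\<lambda>x. fst (prod_decode (f x)))"
  using composition[OF left] .

lemma closed_snd: "P f \<Longrightarrow> P (\<lambda>x. snd (prod_decode (f x)))"
  using composition[OF right] .

lemma closed_const: "P (\<lambda>_. c)"
  by (induction c) (auto intro: zero closed_Suc)

text \<open>The input \<open>x\<close> itself is the parameter of Kleene's schema, so
  \<open>f\<close>, \<open>g\<close> and \<open>n\<close> may all depend on it.\<close>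

lemma closed_rec:
  assumes "P f"
    and "P (\<lambda>z. g (fst (prod_decode z)) (fst (prod_decode (snd (prod_decode z))))
      (snd (prod_decode (snd (prod_decode z)))))"
    and "P n"
  shows "P (\<lambda>x. rec_nat (f x) (g x) (n x))"
  using composition[OF recursion[OF assms(1,2)] pairing[OF closed_id assms(3)]] by simp

section \<open>Arithmetic and decidable predicates\<close>

lemma closed_add:
  assumes "P f" "P g"
  shows "P (\<lambda>x. f x + g x)"
proof -
  have "a + b = rec_nat a (\<lambda>_ r. Suc r) b" for a b :: nat
    by (induction b) auto
  then show ?thesis
    using closed_rec[of f "\<lambda>_ _ r. Suc r" g]
    by (simp add: assms closed_Suc closed_snd closed_id)
qed

lemma closed_pred:
  assumes "P f"
  shows "P (\<lambda>x. f x - 1)"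
proof -
  have "f x - 1 = rec_nat 0 (\<lambda>m _. m) (f x)" for x
    by (cases "f x") auto
  then show ?thesis
    using closed_rec[of "\<lambda>_. 0" "\<lambda>_ m _. m" f]
    by (simp add: assms closed_const closed_fst closed_snd closed_id)
qed

lemma closed_diff:
  assumes "P f" "P g"
  shows "P (\<lambda>x. f x - g x)"
proof -
  have "a - b = rec_nat a (\<lambda>_ r. r - 1) b" for a b :: nat
    by (induction b) auto
  from this[of "f _" "g _"] show ?thesis
    using closed_rec[of f "\<lambda>_ _ r. r - 1" g] closed_pred[OF closed_snd[OF closed_snd[OF closed_id]]]
    by (simp add: assms)
qed

lemma closed_sum:
  assumes "P n" "P (\<lambda>z. g (fst (prod_decode z)) (snd (prod_decode z)))"
  shows "P (\<lambda>x. \<Sum>m<n x. g x m)"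
proof -
  have "(\<Sum>m<k. g x m) = rec_nat 0 (\<lambda>m r. r + g x m) k" for k x
    by (induction k) auto
  moreover have "P (\<lambda>z. g (fst (prod_decode z)) (fst (prod_decode (snd (prod_decode z)))))"
    using composition[OF assms(2), of "\<lambda>z. pair (fst (prod_decode z)) (fst (prod_decode (snd (prod_decode z))))"]
    by (simp add: pairing closed_fst closed_snd closed_id)
  ultimately show ?thesis
    using closed_rec[of "\<lambda>_. 0" "\<lambda>x m r. r + g x m" n]
    by (simp add: assms closed_const closed_add closed_snd closed_id)
qed

lemma closed_not:
  assumes "P (\<lambda>x. of_bool (Q x))"
  shows "P (\<lambda>x. of_bool (\<not> Q x))"
proof -
  have eq: "of_bool (\<not> Q x) = (1::nat) - of_bool (Q x)" for x
    by simp
  show ?thesis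
    unfolding eq by (intro closed_diff closed_const assms)
qed

lemma closed_pos:
  assumes "P f"
  shows "P (\<lambda>x. of_bool (0 < f x))"
proof -
  have eq: "of_bool (0 < f x) = 1 - (1 - f x)" for x
    by simp
  show ?thesis
    unfolding eq by (intro closed_diff closed_const assms)
qed

lemma closed_or:
  assumes "P (\<lambda>x. of_bool (Q x))" "P (\<lambda>x. of_bool (Q' x))"
  shows "P (\<lambda>x. of_bool (Q x \<or> Q' x))"
proof -
  have "(Q x \<or> Q' x) \<longleftrightarrow> 0 < of_bool (Q x) + (of_bool (Q' x) :: nat)" for x
    by simp
  then show ?thesis
    using closed_pos[OF closed_add[OF assms]] by simp
qed

lemma closed_and:
  assumes "P (\<lambda>x. of_bool (Q x))" "P (\<lambda>x. of_bool (Q' x))"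
  shows "P (\<lambda>x. of_bool (Q x \<and> Q' x))"
proof -
  have eq: "Q x \<and> Q' x \<longleftrightarrow> \<not> (\<not> Q x \<or> \<not> Q' x)" for x
    by simp
  show ?thesis
    unfolding eq by (intro closed_not closed_or assms)
qed

lemma closed_imp:
  assumes "P (\<lambda>x. of_bool (Q x))" "P (\<lambda>x. of_bool (Q' x))"
  shows "P (\<lambda>x. of_bool (Q x \<longrightarrow> Q' x))"
  unfolding imp_conv_disj by (intro closed_not closed_or assms)

lemma closed_eq:
  assumes "P f" "P g"
  shows "P (\<lambda>x. of_bool (f x = g x))"
proof -
  have eq: "f x = g x \<longleftrightarrow> \<not> 0 < (f x - g x) + (g x - f x)" for x
    by auto
  show ?thesis
    unfolding eq
    by (intro closed_not closed_pos closed_add closed_diff assms)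
qed

lemma closed_ex:
  assumes "P n" "P (\<lambda>z. of_bool (Q (fst (prod_decode z)) (snd (prod_decode z))))"
  shows "P (\<lambda>x. of_bool (\<exists>m<n x. Q x m))"
proof -
  have "(\<exists>m<n x. Q x m) \<longleftrightarrow> 0 < (\<Sum>m<n x. of_bool (Q x m) :: nat)" for x
    by (auto simp: sum_pos2 simp flip: neq0_conv)
  then show ?thesis
    using closed_pos[OF closed_sum[OF assms(1), of "\<lambda>x m. of_bool (Q x m)", OF assms(2)]] by simp
qed

lemma closed_all:
  assumes "P n" "P (\<lambda>z. of_bool (Q (fst (prod_decode z)) (snd (prod_decode z))))"
  shows "P (\<lambda>x. of_bool (\<forall>m<n x. Q x m))"
proof -
  have eq: "(\<forall>m<n x. Q x m) \<longleftrightarrow> \<not> (\<exists>m<n x. \<not> Q x m)" for x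
    by simp
  show ?thesis
    unfolding eq by (intro closed_not closed_ex assms)
qed

lemma closed_if:
  assumes "P (\<lambda>x. of_bool (Q x))" "P f" "P g"
  shows "P (\<lambda>x. if Q x then f x else g x)"
proof -
  have "(if Q x then f x else g x) = rec_nat (g x) (\<lambda>_ _. f x) (of_bool (Q x))" for x
    by simp
  then show ?thesis
    using closed_rec[of g "\<lambda>x _ _. f x" "\<lambda>x. of_bool (Q x)"] assms composition[OF assms(2) left]
    by simp
qed

lemmas closed_intros =
  closed_const closed_id closed_Suc closed_fst closed_snd pairing closed_add closed_diff
  closed_sum closed_not closed_or closed_and closed_imp closed_eq closed_ex closed_all closed_if

end

section \<open>Total recursive functions\<close>

abbreviation total_recursive_in :: "(nat \<rightharpoonup> nat) set \<Rightarrow> (nat \<Rightarrow> nat) \<Rightarrow> bool" where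
  "total_recursive_in F f \<equiv> recursive_in F (\<lambda>x. Some (f x))"

lemma prim_rec_closed_total_recursive_in: "prim_rec_closed (total_recursive_in F)"
proof
  show "total_recursive_in F (\<lambda>x. pair (f x) (g x))"
    if "total_recursive_in F f" "total_recursive_in F g" for f g
    using recursive_in.pairing[OF that] by simp
  show "total_recursive_in F (\<lambda>x. f (g x))"
    if "total_recursive_in F f" "total_recursive_in F g" for f g
    using recursive_in.composition[OF that] by simp
  show "total_recursive_in F (\<lambda>x. rec_nat (f (fst (prod_decode x)))
      (\<lambda>m r. g (pair (fst (prod_decode x)) (pair m r))) (snd (prod_decode x)))"
    if "total_recursive_in F f" "total_recursive_in F g" for f g
  proof -
    have "rec_nat (Some (f a)) (\<lambda>m r. Option.bind r (\<lambda>v. Some (g (pair a (pair m v))))) n =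
        Some (rec_nat (f a) (\<lambda>m r. g (pair a (pair m r))) n)" for a n
      by (induction n) auto
    then show ?thesis
      using recursive_in.prim_rec[OF that] by (simp add: prim_recursion_def case_prod_beta)
  qed
qed (rule recursive_in.intros)+

lemma recursive_in_mono: "recursive_in F f \<Longrightarrow> F \<subseteq> G \<Longrightarrow> recursive_in G f"
  by (induction rule: recursive_in.induct) (auto intro: recursive_in.intros)

lemma computable_imp_total_recursive_in: "computable f \<Longrightarrow> total_recursive_in F f"
  unfolding computable_def using recursive_in_mono by blast

lemma prim_rec_closed_computable: "prim_rec_closed computable"
proof -
  have "computable = total_recursive_in {}"
    by (auto simp: computable_def)
  then show ?thesis
    by (rule ssubst) (rule prim_rec_closed_total_recursive_in)
qed

interpretation comp: prim_rec_closed computable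
  by (rule prim_rec_closed_computable)

lemma char_fun_eq_of_bool: "char_fun A x = of_bool (x \<in> A)"
  by (simp add: char_fun_def)

lemma mem_rel_code_iff: "pair x y \<in> rel_code R \<longleftrightarrow> (x, y) \<in> R"
  by (auto simp: rel_code_def)

section \<open>Relatively c.e. sets\<close>

lemma ce_in_projection:
  assumes "total_recursive_in {\<lambda>x. Some (char_fun A x)} f"
  shows "ce_in A {x. \<exists>n. f (pair x n) = 0}"
proof -
  \<comment> \<open>As \<open>f\<close> is total, the definedness clause of the search holds
    automatically.\<close>
  have "dom (minimisation (\<lambda>x. Some (f x))) = {x. \<exists>n. f (pair x n) = 0}"
    by (auto simp: minimisation_def split: if_splits)
  then show ?thesis
    unfolding ce_in_def using recursive_in.minimise[OF assms] by metis
qed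

lemma ce_in_decidable:
  assumes "total_recursive_in {\<lambda>x. Some (char_fun A x)} (\<lambda>x. of_bool (Q x))"
  shows "ce_in A {x. Q x}"
proof -
  interpret prim_rec_closed "total_recursive_in {\<lambda>x. Some (char_fun A x)}"
    by (rule prim_rec_closed_total_recursive_in)
  show ?thesis
    \<comment> \<open>The projected coordinate is a dummy: the test for the negation is 0 exactly
      where \<open>Q\<close> holds.\<close>
    using ce_in_projection[OF composition[OF closed_not[OF assms] left]] by simp
qed

lemma ce_in_range:
  assumes "computable f"
  shows "ce_in A (range f)"
proof -
  have "computable (\<lambda>z. of_bool (fst (prod_decode z) \<noteq> f (snd (prod_decode z))))"
    by (intro comp.closed_intros comp.composition[OF assms])
  from ce_in_projection[OF computable_imp_total_recursive_in[OF this]]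
  show ?thesis
    by (simp add: image_def)
qed

lemma computable_funpow:
  assumes "computable p"
  shows "computable (\<lambda>n. (p ^^ n) y)"
proof -
  have "(p ^^ n) y = rec_nat y (\<lambda>_. p) n" for n
    by (induction n) auto
  then show ?thesis
    using comp.closed_rec[of "\<lambda>_. y" "\<lambda>_ _. p" "\<lambda>n. n"]
    by (simp add: comp.composition[OF assms] comp.closed_const comp.closed_id comp.closed_snd)
qed

section \<open>The limit lemma\<close>

text \<open>Shoenfield's approximation by stages \<open>s\<close>; it replaces computation relative
  to the halting problem.\<close>

definition limit_computable :: "(nat \<Rightarrow> nat) \<Rightarrow> bool" where
  "limit_computable h \<longleftrightarrow>
     (\<exists>g. computable g \<and> (\<forall>x. \<forall>\<^sub>F s in sequentially. g (pair x s) = h x))"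

lemma limit_computableI:
  assumes "computable (\<lambda>z. g (fst (prod_decode z)) (snd (prod_decode z)))"
    and "\<And>x. \<forall>\<^sub>F s in sequentially. g x s = h x"
  shows "limit_computable h"
  unfolding limit_computable_def using assms by (intro exI conjI allI) auto

lemma limit_computableE:
  assumes "limit_computable h"
  obtains g where "\<And>u v. computable u \<Longrightarrow> computable v \<Longrightarrow> computable (\<lambda>z. g (u z) (v z))"
    and "\<And>x. \<forall>\<^sub>F s in sequentially. g x s = h x"
proof -
  obtain g where g: "computable g" "\<And>x. \<forall>\<^sub>F s in sequentially. g (pair x s) = h x"
    using assms limit_computable_def by auto
  show thesis
    using that[of "\<lambda>x s. g (pair x s)"] g comp.composition[OF g(1) comp.pairing] by blast
qed

lemma computable_imp_limit_computable:
  assumes "computable f"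
  shows "limit_computable f"
  by (rule limit_computableI[of "\<lambda>x _. f x"]) (use comp.composition[OF assms comp.left] in auto)

text \<open>Each value consults only finitely many approximated values, and at a late enough stage
  all of these are correct at once.\<close>

interpretation lim: prim_rec_closed limit_computable
proof
  fix f g
  assume f: "limit_computable f" and g: "limit_computable g"
  obtain f' where f': "\<And>u v. computable u \<Longrightarrow> computable v \<Longrightarrow> computable (\<lambda>z. f' (u z) (v z))"
    "\<And>x. \<forall>\<^sub>F s in sequentially. f' x s = f x"
    using limit_computableE[OF f] by metis
  obtain g' where g': "\<And>u v. computable u \<Longrightarrow> computable v \<Longrightarrow> computable (\<lambda>z. g' (u z) (v z))"
    "\<And>x. \<forall>\<^sub>F s in sequentially. g' x s = g x"
    using limit_computableE[OF g] by metis
  show "limit_computable (\<lambda>x. pair (f x) (g x))"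
  proof (rule limit_computableI[of "\<lambda>x s. pair (f' x s) (g' x s)"])
    show "\<forall>\<^sub>F s in sequentially. pair (f' x s) (g' x s) = pair (f x) (g x)" for x
      using f'(2)[of x] g'(2)[of x] by eventually_elim simp
  qed (intro comp.closed_intros f' g')
  show "limit_computable (\<lambda>x. f (g x))"
  proof (rule limit_computableI[of "\<lambda>x s. f' (g' x s) s"])
    show "\<forall>\<^sub>F s in sequentially. f' (g' x s) s = f (g x)" for x
      using f'(2)[of "g x"] g'(2)[of x] by eventually_elim simp
  qed (intro comp.closed_intros f' g')
  show "limit_computable (\<lambda>x. rec_nat (f (fst (prod_decode x)))
      (\<lambda>m r. g (pair (fst (prod_decode x)) (pair m r))) (snd (prod_decode x)))"
  proof (rule limit_computableI[of "\<lambda>x s. rec_nat (f' (fst (prod_decode x)) s)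
      (\<lambda>m r. g' (pair (fst (prod_decode x)) (pair m r)) s) (snd (prod_decode x))"])
    \<comment> \<open>Once the first \<open>n\<close> rounds have settled, the argument of round
      \<open>n\<close> is a fixed number, at which \<open>g'\<close> settles too.\<close>
    have "\<forall>\<^sub>F s in sequentially. rec_nat (f' a s) (\<lambda>m r. g' (pair a (pair m r)) s) n =
        rec_nat (f a) (\<lambda>m r. g (pair a (pair m r))) n" for a n
    proof (induction n)
      case 0
      then show ?case using f'(2) by simp
    next
      case (Suc n)
      then show ?case
        using g'(2)[of "pair a (pair n (rec_nat (f a) (\<lambda>m r. g (pair a (pair m r))) n))"]
        by eventually_elim simp
    qed
    then show "\<forall>\<^sub>F s in sequentially. rec_nat (f' (fst (prod_decode x)) s)
        (\<lambda>m r. g' (pair (fst (prod_decode x)) (pair m r)) s) (snd (prod_decode x)) =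
      rec_nat (f (fst (prod_decode x)))
        (\<lambda>m r. g (pair (fst (prod_decode x)) (pair m r))) (snd (prod_decode x))" for x .
  qed (intro comp.closed_rec comp.closed_intros f' g')
qed (intro computable_imp_limit_computable comp.zero comp.succ comp.left comp.right)+

text \<open>The complement in the successor level turns the inner existential quantifier into a
  universal one.\<close>

lemma Sigma0_2_iff:
  "A \<in> Sigma0 2 \<longleftrightarrow>
     (\<exists>C. computable (\<lambda>z. of_bool (z \<in> C)) \<and> A = {x. \<exists>y. \<forall>w. pair (pair x y) w \<in> C})"
  (is "_ \<longleftrightarrow> ?R")
proof
  assume "A \<in> Sigma0 2"
  then show ?R
    by (auto simp: numeral_2_eq_2 char_fun_eq_of_bool[abs_def])
next
  assume ?R
  then obtain C where C: "C \<in> Sigma0 0" and A: "A = {x. \<exists>y. \<forall>w. pair (pair x y) w \<in> C}"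
    by (auto simp: char_fun_eq_of_bool[abs_def])
  let ?B = "{z. \<exists>w. pair z w \<in> - C}"
  have "?B \<in> Sigma0 1"
    using C unfolding One_nat_def Sigma0.simps(2) by blast
  moreover have "A = {x. \<exists>y. pair x y \<in> - ?B}"
    unfolding A by simp
  ultimately show "A \<in> Sigma0 2"
    unfolding One_nat_def numeral_2_eq_2 Sigma0.simps(2)[of "Suc 0"] by blast
qed

text \<open>Membership means that from some stage on the guess is always 1.\<close>

lemma limit_computable_imp_Sigma0_2:
  assumes "limit_computable (\<lambda>x. of_bool (x \<in> A))"
  shows "A \<in> Sigma0 2"
proof -
  obtain g where g: "\<And>u v. computable u \<Longrightarrow> computable v \<Longrightarrow> computable (\<lambda>z. g (u z) (v z))"
    "\<And>x. \<forall>\<^sub>F s in sequentially. g x s = of_bool (x \<in> A)"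
    using limit_computableE[OF assms] by metis
  define C where "C = {z. g (fst (prod_decode (fst (prod_decode z))))
    (snd (prod_decode (fst (prod_decode z))) + snd (prod_decode z)) = 1}"
  have "computable (\<lambda>z. of_bool (z \<in> C))"
    unfolding C_def mem_Collect_eq by (intro comp.closed_intros g)
  moreover have "x \<in> A \<longleftrightarrow> (\<exists>y. \<forall>w. pair (pair x y) w \<in> C)" for x
  proof -
    obtain s where s: "\<And>t. t \<ge> s \<Longrightarrow> g x t = of_bool (x \<in> A)"
      using g(2)[of x] unfolding eventually_sequentially by blast
    \<comment> \<open>Stage \<open>y + s\<close> lies beyond the point of stabilisation even if
      \<open>y\<close> does not.\<close>
    have "x \<in> A" if "\<forall>w. g x (y + w) = 1" for y
      using that[rule_format, of s] s[of "y + s"] by (cases "x \<in> A") auto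
    then show ?thesis
      unfolding C_def using s by (auto intro!: exI[of _ s])
  qed
  ultimately show ?thesis
    unfolding Sigma0_2_iff by blast
qed

text \<open>The limit lemma for sets. For the converse direction, witnesses for \<open>A\<close> and
  for its complement race against each other.\<close>

lemma Delta0_2_iff_limit_computable:
  "A \<in> Delta0 2 \<longleftrightarrow> limit_computable (\<lambda>x. of_bool (x \<in> A))"
proof
  assume lim: "limit_computable (\<lambda>x. of_bool (x \<in> A))"
  have "limit_computable (\<lambda>x. of_bool (x \<in> - A))"
    using lim.closed_not[OF lim] by simp
  with lim have "A \<in> Sigma0 2" "- A \<in> Sigma0 2"
    by (auto intro: limit_computable_imp_Sigma0_2)
  then show "A \<in> Delta0 2"
    unfolding Delta0_def Pi0_def by (auto intro!: exI[of _ "- A"] simp del: Sigma0.simps)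
next
  assume "A \<in> Delta0 2"
  then have "A \<in> Sigma0 2" "- A \<in> Sigma0 2"
    by (auto simp: Delta0_def Pi0_def)
  then obtain C D where C: "computable (\<lambda>z. of_bool (z \<in> C))"
    and D: "computable (\<lambda>z. of_bool (z \<in> D))"
    and A: "A = {x. \<exists>y. \<forall>w. pair (pair x y) w \<in> C}"
    and nA: "- A = {x. \<exists>y. \<forall>w. pair (pair x y) w \<in> D}"
    unfolding Sigma0_2_iff by blast
  have memA: "x \<in> A \<longleftrightarrow> (\<exists>y. \<forall>w. pair (pair x y) w \<in> C)"
    and memnA: "x \<notin> A \<longleftrightarrow> (\<exists>y. \<forall>w. pair (pair x y) w \<in> D)" for x
    using A nA by (simp_all add: set_eq_iff)
  \<comment> \<open>Guess that \<open>x \<in> A\<close> if the least \<open>y\<close> that still looks like a witness looks like one for \<open>A\<close>.\<close>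
  define Q where "Q x s \<longleftrightarrow> (\<exists>y<s. (\<forall>w<s. pair (pair x y) w \<in> C) \<and>
    (\<forall>y'<y. \<not> (\<forall>w<s. pair (pair x y') w \<in> D)))" for x s
  \<comment> \<open>Each of the finitely many false candidates below \<open>b\<close> has a
    counterexample \<open>k y\<close>, which is seen once \<open>s\<close> exceeds it.\<close>
  have refuted: "\<forall>\<^sub>F s in sequentially. \<forall>y<b. \<not> (\<forall>w<s. pair (pair x y) w \<in> E)"
    if "\<not> (\<exists>y. \<forall>w. pair (pair x y) w \<in> E)" for x b and E :: "nat set"
  proof -
    have "\<forall>y. \<exists>w. pair (pair x y) w \<notin> E"
      using that by simp
    then obtain k where k: "\<forall>y. pair (pair x y) (k y) \<notin> E"
      by (rule choice[THEN exE])
    have "\<forall>\<^sub>F s in sequentially. \<forall>y\<in>{..<b}. k y < s"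
      by (intro eventually_ball_finite) (auto simp: eventually_gt_at_top)
    then show ?thesis
      by eventually_elim (use k in blast)
  qed
  show "limit_computable (\<lambda>x. of_bool (x \<in> A))"
  proof (rule limit_computableI[of "\<lambda>x s. of_bool (Q x s)"])
    show "computable (\<lambda>z. of_bool (Q (fst (prod_decode z)) (snd (prod_decode z))))"
      unfolding Q_def by (intro comp.closed_intros comp.composition[OF C] comp.composition[OF D])
  next
    fix x
    show "\<forall>\<^sub>F s in sequentially. of_bool (Q x s) = (of_bool (x \<in> A) :: nat)"
    proof (cases "x \<in> A")
      case True
      then obtain y where y: "\<forall>w. pair (pair x y) w \<in> C"
        using memA by blast
      have "\<forall>\<^sub>F s in sequentially. y < s"
        by (rule eventually_gt_at_top)
      moreover have "\<forall>\<^sub>F s in sequentially. \<forall>y'<y. \<not> (\<forall>w<s. pair (pair x y') w \<in> D)"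
        using refuted True memnA by blast
      ultimately show ?thesis
        by eventually_elim (use y True in \<open>auto simp: Q_def\<close>)
    next
      case False
      then obtain y where y: "\<forall>w. pair (pair x y) w \<in> D"
        using memnA by blast
      \<comment> \<open>The bound \<open>Suc y\<close> includes \<open>y\<close> itself; any
        candidate beyond \<open>y\<close> is blocked because \<open>y\<close> is never refuted as a
        witness for \<open>D\<close>.\<close>
      have "\<forall>\<^sub>F s in sequentially. \<forall>y'<Suc y. \<not> (\<forall>w<s. pair (pair x y') w \<in> C)"
        using refuted False memA by blast
      then show ?thesis
      proof eventually_elim
        case (elim s)
        have "\<not> Q x s"
          unfolding Q_def using elim y by (metis not_less_eq)
        then show ?case using False by simp
      qed
    qed
  qed
qed

section \<open>Numbering the classes\<close>

text \<open>Classes are numbered in the order of their least elements; the sum counts the least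
  elements of classes below that of \<open>a\<close>.\<close>

definition class_index :: "nat rel \<Rightarrow> nat \<Rightarrow> nat" where
  "class_index R a = (\<Sum>n<a. of_bool ((\<forall>m<n. (m, n) \<notin> R) \<and> (\<forall>m<Suc n. (m, a) \<notin> R)))"

lemma class_index_eq_card:
  assumes "equiv UNIV R"
  shows "class_index R a = card {n. (\<forall>m<n. (m, n) \<notin> R) \<and> (\<forall>m\<le>n. (m, a) \<notin> R)}"
proof -
  have "(a, a) \<in> R"
    using assms by (auto elim: equivE dest: refl_onD)
  then have "{n. (\<forall>m<n. (m, n) \<notin> R) \<and> (\<forall>m\<le>n. (m, a) \<notin> R)} =
      {..<a} \<inter> {n. (\<forall>m<n. (m, n) \<notin> R) \<and> (\<forall>m<Suc n. (m, a) \<notin> R)}"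
    by (auto simp: less_Suc_eq_le not_less[symmetric])
  then show ?thesis
    by (simp add: class_index_def sum.If_cases of_bool_def)
qed

text \<open>With \<open>M\<close> the set of least elements and \<open>l a\<close> the least element
  of the class of \<open>a\<close>, the index counts the members of \<open>M\<close> below
  \<open>l a\<close>. It is thus strictly increasing in \<open>l a\<close>, and the
  \<open>k\<close>-th member of \<open>M\<close> has index \<open>k\<close>.\<close>

lemma
  assumes R: "equiv UNIV R"
  shows class_index_eq_iff: "class_index R a = class_index R b \<longleftrightarrow> (a, b) \<in> R"
    and surj_class_index: "infinite (UNIV // R) \<Longrightarrow> surj (class_index R)"
proof -
  have refl: "(x, x) \<in> R" for x
    using R by (auto elim: equivE dest: refl_onD)
  have sym: "(x, y) \<in> R \<longleftrightarrow> (y, x) \<in> R" for x y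
    using R by (auto elim!: equivE dest: symD)
  have trans: "(x, y) \<in> R \<Longrightarrow> (y, z) \<in> R \<Longrightarrow> (x, z) \<in> R" for x y z
    using R by (auto elim!: equivE dest: transD)
  define M where "M = {n. \<forall>m<n. (m, n) \<notin> R}"
  define l where "l a = (LEAST m. (m, a) \<in> R)" for a
  have l: "(l a, a) \<in> R" for a
    unfolding l_def by (rule LeastI, rule refl)
  have l_le: "l a \<le> m" if "(m, a) \<in> R" for a m
    unfolding l_def by (rule Least_le, rule that)
  have l_M: "l a \<in> M" for a
    unfolding M_def using l_le[OF trans[OF _ l]] by (auto simp: not_less[symmetric])
  have l_eq: "l a = a" if "a \<in> M" for a
    using that l[of a] l_le[OF refl[of a]] unfolding M_def by (auto simp: le_less)
  have idx: "class_index R a = card {n \<in> M. n < l a}" for a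
  proof -
    have "(\<forall>m\<le>n. (m, a) \<notin> R) \<longleftrightarrow> n < l a" for n
      using l[of a] l_le[of _ a] by (meson leD leI le_trans)
    then show ?thesis
      by (simp add: class_index_eq_card[OF R] M_def)
  qed
  have less: "class_index R a < class_index R b" if "l a < l b" for a b
  proof -
    have "{n \<in> M. n < l a} \<subset> {n \<in> M. n < l b}"
      using that l_M[of a] by auto
    then show ?thesis
      unfolding idx by (intro psubset_card_mono) auto
  qed
  have l_iff: "l a = l b \<longleftrightarrow> (a, b) \<in> R" for a b
  proof
    show "(a, b) \<in> R" if "l a = l b"
      using trans[of a "l a" b] l[of a] l[of b] that sym[of a "l a"] by simp
    show "l a = l b" if "(a, b) \<in> R"
      unfolding l_def using that sym trans by (intro arg_cong[of _ _ Least] ext) blast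
  qed
  show "class_index R a = class_index R b \<longleftrightarrow> (a, b) \<in> R"
  proof -
    have "class_index R a = class_index R b \<longleftrightarrow> l a = l b"
      using less[of a b] less[of b a] by (cases "l a" "l b" rule: linorder_cases) (auto simp: idx)
    then show ?thesis using l_iff by simp
  qed
  show "surj (class_index R)" if inf: "infinite (UNIV // R)"
  proof -
    have "UNIV // R \<subseteq> (\<lambda>x. R `` {x}) ` M"
    proof
      fix X
      assume "X \<in> UNIV // R"
      then obtain a where "X = R `` {a}"
        by (auto simp: quotient_def)
      then have "X = R `` {l a}"
        using equiv_class_eq[OF R l] by simp
      then show "X \<in> (\<lambda>x. R `` {x}) ` M"
        using l_M by blast
    qed
    with inf have M: "infinite M"
      using finite_surj by blast
    have "class_index R (enumerate M k) = k" for k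
    proof -
      have "enumerate M k \<in> M"
        using M by (rule enumerate_in_set)
      moreover have "{n \<in> M. n < enumerate M k} = enumerate M ` {..<k}"
      proof -
        have "{n \<in> M. n < enumerate M k} = {n \<in> range (enumerate M). n < enumerate M k}"
          by (simp add: range_enumerate[OF M])
        also have "\<dots> = enumerate M ` {..<k}"
          using strict_mono_less[OF strict_mono_enumerate[OF M]] by auto
        finally show ?thesis .
      qed
      moreover have "inj (enumerate M)"
        using strict_mono_enumerate[OF M] by (rule strict_mono_imp_inj_on)
      ultimately show ?thesis
        by (simp add: idx l_eq card_image inj_on_subset)
    qed
    then show ?thesis
      by (rule surjI)
  qed
qed

section \<open>Delta^0_2 relations via limit computability\<close>

lemma limit_computable_rel:
  assumes "Delta02_equiv R" "limit_computable u" "limit_computable v"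
  shows "limit_computable (\<lambda>x. of_bool ((u x, v x) \<in> R))"
proof -
  have "limit_computable (\<lambda>x. of_bool (x \<in> rel_code R))"
    using assms(1) by (simp add: Delta02_equiv_def Delta0_2_iff_limit_computable)
  from lim.composition[OF this lim.pairing[OF assms(2,3)]]
  show ?thesis
    by (simp add: mem_rel_code_iff)
qed

text \<open>The sum and all quantifiers in \<open>class_index\<close> are bounded, so the closure
  rules apply.\<close>

lemma limit_computable_class_index:
  assumes "Delta02_equiv R" "limit_computable u"
  shows "limit_computable (\<lambda>x. class_index R (u x))"
proof -
  have "limit_computable (class_index R)"
    unfolding class_index_def by (intro lim.closed_intros limit_computable_rel assms(1))
  then show ?thesis
    using lim.composition assms(2) by blast
qed

lemma Delta02_equiv_kernel:
  assumes "limit_computable r"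
  shows "Delta02_equiv {(x, y). r x = r y}"
proof -
  have "equiv UNIV {(x, y). r x = r y}"
    by (auto intro!: equivI refl_onI symI transI)
  moreover have "z \<in> rel_code {(x, y). r x = r y} \<longleftrightarrow>
      r (fst (prod_decode z)) = r (snd (prod_decode z))" for z
    using mem_rel_code_iff[of "fst (prod_decode z)" "snd (prod_decode z)"] by (simp add: case_prod_beta)
  ultimately show ?thesis
    unfolding Delta02_equiv_def Delta0_2_iff_limit_computable
    by (simp add: lim.closed_eq lim.composition[OF assms lim.left] lim.composition[OF assms lim.right])
qed

section \<open>Reductions from dark relations\<close>

text \<open>On \<open>M\<close> the function \<open>r\<close> factors through \<open>k\<close>. This
  carries finiteness from one numbering of classes to another.\<close>

lemma finite_image_factor:
  assumes "finite (k ` M)" "\<And>x y. x \<in> M \<Longrightarrow> y \<in> M \<Longrightarrow> k x = k y \<Longrightarrow> r x = r y"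
  shows "finite (r ` M)"
proof -
  have "r ` M \<subseteq> (\<lambda>c. r (inv_into M k c)) ` k ` M"
  proof
    fix b
    assume "b \<in> r ` M"
    then obtain x where x: "x \<in> M" "b = r x" by blast
    then have "inv_into M k (k x) \<in> M" "k (inv_into M k (k x)) = k x"
      by (auto intro: inv_into_into f_inv_into_f)
    with x have "b = r (inv_into M k (k x))"
      using assms(2) by metis
    then show "b \<in> (\<lambda>c. r (inv_into M k c)) ` k ` M"
      using x(1) by blast
  qed
  then show ?thesis
    using assms(1) finite_subset by blast
qed

text \<open>Through \<open>q\<close>, the oracle \<open>S\<close> decides \<open>R\<close> on
  \<open>B\<close>. If \<open>B\<close> met infinitely many classes, picking the first element of
  \<open>B\<close> in each would give an infinite set contradicting darkness.\<close>

lemma finite_classes_reducible_to_oracle: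
  assumes dark: "dark (rel_code S) R"
    and r: "\<And>x y. (x, y) \<in> R \<longleftrightarrow> r x = (r y :: nat)"
    and B: "computable (\<lambda>x. of_bool (B x))" and q: "computable q"
    and red: "\<And>x y. B x \<Longrightarrow> B y \<Longrightarrow> (x, y) \<in> R \<longleftrightarrow> (q x, q y) \<in> S"
  shows "finite (r ` {x. B x})"
proof (rule ccontr)
  assume inf: "infinite (r ` {x. B x})"
  let ?F = "{\<lambda>x. Some (char_fun (rel_code S) x)}"
  interpret prim_rec_closed "total_recursive_in ?F"
    by (rule prim_rec_closed_total_recursive_in)
  \<comment> \<open>The test is phrased with \<open>q\<close> and \<open>S\<close> rather than with
    \<open>R\<close>, so that the oracle can decide it.\<close>
  define W where "W = {x. B x \<and> (\<forall>y<x. B y \<longrightarrow> (q y, q x) \<notin> S)}"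
  have membership: "total_recursive_in ?F (\<lambda>z. of_bool ((u z, v z) \<in> S))"
    if "total_recursive_in ?F u" "total_recursive_in ?F v" for u v
    using composition[OF recursive_in.oracle_call pairing[OF that], of "char_fun (rel_code S)"]
    by (simp add: char_fun_eq_of_bool mem_rel_code_iff)
  have "ce_in (rel_code S) W"
    unfolding W_def
    by (intro ce_in_decidable closed_intros membership
        composition[OF computable_imp_total_recursive_in[OF B]]
        composition[OF computable_imp_total_recursive_in[OF q]])
  moreover have "\<forall>u\<in>W. \<forall>v\<in>W. u \<noteq> v \<longrightarrow> (u, v) \<notin> R"
  proof -
    have "(u, v) \<notin> R \<and> (v, u) \<notin> R" if "u \<in> W" "v \<in> W" "u < v" for u v
      using that red[of u v] r unfolding W_def by auto
    then show ?thesis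
      by (meson linorder_neqE_nat)
  qed
  moreover have "infinite W"
  proof
    assume "finite W"
    have "r ` {x. B x} \<subseteq> r ` W"
    proof clarify
      fix x
      assume x: "B x"
      define y where "y = (LEAST y. B y \<and> r y = r x)"
      have y: "B y \<and> r y = r x"
        unfolding y_def by (rule LeastI[of _ x]) (use x in simp)
      have "\<not> (B z \<and> r z = r x)" if "z < y" for z
        using that unfolding y_def by (rule not_less_Least)
      then have "y \<in> W"
        unfolding W_def mem_Collect_eq using y red[of _ y] r by metis
      then show "r x \<in> r ` W"
        using y by (metis image_eqI)
    qed
    then show False
      using inf \<open>finite W\<close> finite_surj by blast
  qed
  ultimately show False
    using dark unfolding dark_def by blast
qed

text \<open>The orbit under \<open>p\<close> of an element outside the range of \<open>p\<close> is pairwise inequivalent for as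
  long as it avoids \<open>B\<close>, so darkness forces it to enter \<open>B\<close>; orbits starting in different missed
  classes enter \<open>B\<close> in different classes.\<close>

lemma finite_classes_missed:
  assumes dark: "dark A R"
    and r: "\<And>x y. (x, y) \<in> R \<longleftrightarrow> r x = (r y :: nat)"
    and p: "computable p"
    and B: "finite (r ` B)"
    and red: "\<And>x y. x \<notin> B \<Longrightarrow> y \<notin> B \<Longrightarrow> r (p x) = r (p y) \<longleftrightarrow> r x = r y"
  shows "finite (r ` {y. \<forall>x. x \<notin> B \<longrightarrow> r (p x) \<noteq> r y})" (is "finite (r ` ?M)")
proof -
  \<comment> \<open>Outside \<open>B\<close> the map \<open>p\<close> is injective on classes, so
    applications of \<open>p\<close> can be peeled off both sides. If any were left on the right,
    \<open>p\<close> would hit the missed class of \<open>y\<close>.\<close>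
  have cancel: "n = m \<and> r y = r y'"
    if "r ((p ^^ n) y) = r ((p ^^ m) y')" "n \<le> m" "y \<in> ?M"
      "\<And>i. i < n \<Longrightarrow> (p ^^ i) y \<notin> B" "\<And>i. i < m \<Longrightarrow> (p ^^ i) y' \<notin> B" for n m y y'
    using that
  proof (induction n arbitrary: m)
    case 0
    show ?case
    proof (cases m)
      case (Suc k)
      with 0 have "r (p ((p ^^ k) y')) = r y" "(p ^^ k) y' \<notin> B" by auto
      with 0(3) show ?thesis by blast
    qed (use 0 in simp)
  next
    case (Suc n)
    then obtain k where k: "m = Suc k"
      using Suc_le_D by blast
    then have "r ((p ^^ n) y) = r ((p ^^ k) y')"
      using Suc.prems red by simp
    with k Suc.IH[of k] Suc.prems show ?case
      by simp
  qed
  have enters: "\<exists>n. (p ^^ n) y \<in> B" if y: "y \<in> ?M" for y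
  proof (rule ccontr)
    assume avoid: "\<not> (\<exists>n. (p ^^ n) y \<in> B)"
    have eq: "n = m" if "r ((p ^^ n) y) = r ((p ^^ m) y)" for n m
      using cancel[of n y m y] cancel[of m y n y] that y avoid by (metis nat_le_linear)
    then have "inj (\<lambda>n. (p ^^ n) y)"
      by (auto intro: injI)
    then have "infinite (range (\<lambda>n. (p ^^ n) y))"
      using range_inj_infinite by blast
    moreover have "ce_in A (range (\<lambda>n. (p ^^ n) y))"
      by (intro ce_in_range computable_funpow p)
    ultimately show False
      using dark eq unfolding dark_def r by blast
  qed
  define N where "N y = (LEAST n. (p ^^ n) y \<in> B)" for y
  have N: "(p ^^ N y) y \<in> B" if "y \<in> ?M" for y
    unfolding N_def using enters[OF that] by (rule LeastI_ex)
  have less_N: "(p ^^ i) y \<notin> B" if "i < N y" for i y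
    using that unfolding N_def by (rule not_less_Least)
  show ?thesis
  \<comment> \<open>By \<open>cancel\<close>, the class in which an orbit enters \<open>B\<close>
    determines the missed class it started from.\<close>
  proof (rule finite_image_factor[of "\<lambda>y. r ((p ^^ N y) y)"])
    show "finite ((\<lambda>y. r ((p ^^ N y) y)) ` ?M)"
      by (rule finite_subset[OF _ B]) (use N in blast)
    show "r x = r y" if "x \<in> ?M" "y \<in> ?M" "r ((p ^^ N x) x) = r ((p ^^ N y) y)" for x y
      using cancel[of "N x" x "N y" y] cancel[of "N y" y "N x" x] that less_N
      by (metis nat_le_linear)
  qed
qed

section \<open>Sums and matched sums\<close>

text \<open>The sum and the matched sum are the kernels of the following functions; \<open>pair 0 x\<close> stands for the element \<open>x\<close> of the first summand and
  \<open>pair i x\<close> with \<open>i > 0\<close> for the element \<open>x\<close> of the second one.\<close>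

definition matched_index :: "nat rel \<Rightarrow> nat rel \<Rightarrow> nat \<Rightarrow> nat" where
  "matched_index R S z = (if fst (prod_decode z) = 0
     then class_index R (snd (prod_decode z)) else class_index S (snd (prod_decode z)))"

definition sum_index :: "nat rel \<Rightarrow> nat rel \<Rightarrow> nat \<Rightarrow> nat" where
  "sum_index R S z = pair (of_bool (fst (prod_decode z) = 0)) (matched_index R S z)"

lemma limit_computable_matched_index:
  assumes "Delta02_equiv R" "Delta02_equiv S"
  shows "limit_computable (matched_index R S)"
  unfolding matched_index_def[abs_def]
  by (intro lim.closed_intros limit_computable_class_index assms)

lemma limit_computable_sum_index:
  assumes "Delta02_equiv R" "Delta02_equiv S"
  shows "limit_computable (sum_index R S)"
  unfolding sum_index_def[abs_def]
  by (intro lim.closed_intros limit_computable_matched_index assms)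

text \<open>Meant for the injections \<open>pair 0\<close> and \<open>pair 1\<close> into the two
  sums.\<close>

lemma reducible_kernel:
  assumes "equiv UNIV R" "computable i" "\<And>x y. r (i x) = r (i y) \<longleftrightarrow> class_index R x = class_index R y"
  shows "R \<le>\<^sub>c {(x, y). r x = r y}"
  unfolding reducible_def using assms class_index_eq_iff[OF assms(1)]
  by (intro exI[of _ i]) simp

lemma computable_pair_const: "computable (pair c)"
  by (intro comp.closed_intros)

section \<open>Comparing the two upper bounds\<close>

theorem theorem5p1:
  fixes R S :: "nat rel"
  assumes "Delta02_equiv R" and "Delta02_equiv S"
    and "mutually_dark R S"
  shows "\<not> (\<exists>T. Delta02_equiv T \<and> R \<le>\<^sub>c T \<and> S \<le>\<^sub>c T \<and>
           (\<forall>U. Delta02_equiv U \<and> R \<le>\<^sub>c U \<and> S \<le>\<^sub>c U \<longrightarrow> T \<le>\<^sub>c U))"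
proof
  assume "\<exists>T. Delta02_equiv T \<and> R \<le>\<^sub>c T \<and> S \<le>\<^sub>c T \<and>
           (\<forall>U. Delta02_equiv U \<and> R \<le>\<^sub>c U \<and> S \<le>\<^sub>c U \<longrightarrow> T \<le>\<^sub>c U)"
  then obtain T where "R \<le>\<^sub>c T" "S \<le>\<^sub>c T"
    and least: "\<And>U. Delta02_equiv U \<Longrightarrow> R \<le>\<^sub>c U \<Longrightarrow> S \<le>\<^sub>c U \<Longrightarrow> T \<le>\<^sub>c U"
    by blast
  let ?r = "class_index R" and ?s = "class_index S"
  let ?m = "matched_index R S" and ?d = "sum_index R S"
  have R: "equiv UNIV R" and S: "equiv UNIV S"
    using assms by (auto simp: Delta02_equiv_def)
  have darkR: "dark (rel_code S) R" and darkS: "dark (rel_code R) S"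
    using assms by (auto simp: mutually_dark_def)
  note r = class_index_eq_iff[OF R, symmetric] and s = class_index_eq_iff[OF S, symmetric]
  obtain f where f: "computable f" "\<And>x y. (f x, f y) \<in> T \<longleftrightarrow> ?r x = ?r y"
    using \<open>R \<le>\<^sub>c T\<close> r unfolding reducible_def by auto
  obtain g where g: "computable g" "\<And>x y. (g x, g y) \<in> T \<longleftrightarrow> ?s x = ?s y"
    using \<open>S \<le>\<^sub>c T\<close> s unfolding reducible_def by auto
  have "T \<le>\<^sub>c {(x, y). ?m x = ?m y}"
    by (intro least Delta02_equiv_kernel limit_computable_matched_index assms
        reducible_kernel[OF R computable_pair_const[of 0]]
        reducible_kernel[OF S computable_pair_const[of 1]]) (simp_all add: matched_index_def)
  then obtain \<phi> where \<phi>: "computable \<phi>" "\<And>x y. (x, y) \<in> T \<longleftrightarrow> ?m (\<phi> x) = ?m (\<phi> y)"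
    unfolding reducible_def by auto
  have "T \<le>\<^sub>c {(x, y). ?d x = ?d y}"
    by (intro least Delta02_equiv_kernel limit_computable_sum_index assms
        reducible_kernel[OF R computable_pair_const[of 0]]
        reducible_kernel[OF S computable_pair_const[of 1]])
      (simp_all add: matched_index_def sum_index_def)
  then obtain h where h: "computable h" "\<And>x y. (x, y) \<in> T \<longleftrightarrow> ?d (h x) = ?d (h y)"
    unfolding reducible_def by auto
  define side where "side z = fst (prod_decode z)" for z :: nat
  define elt where "elt z = snd (prod_decode z)" for z :: nat
  have comp_side: "computable (\<lambda>x. side (k (l x)))" and comp_elt: "computable (\<lambda>x. elt (k (l x)))"
    if "computable k" "computable l" for k l
    unfolding side_def elt_def
    using comp.closed_fst[OF comp.composition[OF that]] comp.closed_snd[OF comp.composition[OF that]]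
    by simp_all
  have m: "?m z = (if side z = 0 then ?r (elt z) else ?s (elt z))" for z
    by (simp add: matched_index_def side_def elt_def)
  have d: "?d z = ?d z' \<longleftrightarrow> (side z = 0 \<longleftrightarrow> side z' = 0) \<and> ?m z = ?m z'" for z z'
    by (auto simp: sum_index_def side_def)
  \<comment> \<open>Composing through \<open>T\<close> yields reductions of \<open>R\<close> and
    \<open>S\<close> to both kernels.\<close>
  have \<phi>f: "?m (\<phi> (f x)) = ?m (\<phi> (f y)) \<longleftrightarrow> ?r x = ?r y"
    and \<phi>g: "?m (\<phi> (g x)) = ?m (\<phi> (g y)) \<longleftrightarrow> ?s x = ?s y"
    and hf: "?d (h (f x)) = ?d (h (f y)) \<longleftrightarrow> ?r x = ?r y"
    and hg: "?d (h (g x)) = ?d (h (g y)) \<longleftrightarrow> ?s x = ?s y" for x y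
    by (simp_all flip: f(2) g(2) \<phi>(2) h(2))
  \<comment> \<open>These sets collect the elements sent to the wrong side, by way of
    \<open>\<phi>\<close> into the matched sum and by way of \<open>h\<close> into the plain
    sum.\<close>
  let ?B1 = "{x. side (\<phi> (f x)) \<noteq> 0}" and ?B2 = "{x. side (\<phi> (g x)) = 0}"
  let ?H1 = "{x. side (h (f x)) \<noteq> 0}" and ?H2 = "{x. side (h (g x)) = 0}"
  have B1: "finite (?r ` ?B1)"
  proof (rule finite_classes_reducible_to_oracle[OF darkR r, where q = "\<lambda>x. elt (\<phi> (f x))"])
    show "computable (\<lambda>x. of_bool (side (\<phi> (f x)) \<noteq> 0))"
      by (intro comp.closed_intros comp_side[OF \<phi>(1) f(1)])
    show "computable (\<lambda>x. elt (\<phi> (f x)))"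
      by (rule comp_elt[OF \<phi>(1) f(1)])
    show "(x, y) \<in> R \<longleftrightarrow> (elt (\<phi> (f x)), elt (\<phi> (f y))) \<in> S"
      if "side (\<phi> (f x)) \<noteq> 0" "side (\<phi> (f y)) \<noteq> 0" for x y
      using \<phi>f[of x y] that by (simp add: r s m)
  qed
  have B2: "finite (?s ` ?B2)"
  proof (rule finite_classes_reducible_to_oracle[OF darkS s, where q = "\<lambda>x. elt (\<phi> (g x))"])
    show "computable (\<lambda>x. of_bool (side (\<phi> (g x)) = 0))"
      by (intro comp.closed_intros comp_side[OF \<phi>(1) g(1)])
    show "computable (\<lambda>x. elt (\<phi> (g x)))"
      by (rule comp_elt[OF \<phi>(1) g(1)])
    show "(x, y) \<in> S \<longleftrightarrow> (elt (\<phi> (g x)), elt (\<phi> (g y))) \<in> R"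
      if "side (\<phi> (g x)) = 0" "side (\<phi> (g y)) = 0" for x y
      using \<phi>g[of x y] that by (simp add: r s m)
  qed
  have H1: "finite (?r ` ?H1)"
  proof (rule finite_classes_reducible_to_oracle[OF darkR r, where q = "\<lambda>x. elt (h (f x))"])
    show "computable (\<lambda>x. of_bool (side (h (f x)) \<noteq> 0))"
      by (intro comp.closed_intros comp_side[OF h(1) f(1)])
    show "computable (\<lambda>x. elt (h (f x)))"
      by (rule comp_elt[OF h(1) f(1)])
    show "(x, y) \<in> R \<longleftrightarrow> (elt (h (f x)), elt (h (f y))) \<in> S"
      if "side (h (f x)) \<noteq> 0" "side (h (f y)) \<noteq> 0" for x y
      using hf[of x y] that by (simp add: r s m d)
  qed
  have H2: "finite (?s ` ?H2)"
  proof (rule finite_classes_reducible_to_oracle[OF darkS s, where q = "\<lambda>x. elt (h (g x))"])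
    show "computable (\<lambda>x. of_bool (side (h (g x)) = 0))"
      by (intro comp.closed_intros comp_side[OF h(1) g(1)])
    show "computable (\<lambda>x. elt (h (g x)))"
      by (rule comp_elt[OF h(1) g(1)])
    show "(x, y) \<in> S \<longleftrightarrow> (elt (h (g x)), elt (h (g y))) \<in> R"
      if "side (h (g x)) = 0" "side (h (g y)) = 0" for x y
      using hg[of x y] that by (simp add: r s m d)
  qed
  \<comment> \<open>These are the elements whose classes are missed by the part of the reduction
    that stays on its own side.\<close>
  let ?M1 = "{y. \<forall>x. x \<notin> ?B1 \<longrightarrow> ?r (elt (\<phi> (f x))) \<noteq> ?r y}"
  let ?M2 = "{y. \<forall>x. x \<notin> ?B2 \<longrightarrow> ?s (elt (\<phi> (g x))) \<noteq> ?s y}"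
  have M1: "finite (?r ` ?M1)"
  proof (rule finite_classes_missed[OF darkR r comp_elt[OF \<phi>(1) f(1)] B1])
    show "?r (elt (\<phi> (f x))) = ?r (elt (\<phi> (f y))) \<longleftrightarrow> ?r x = ?r y"
      if "x \<notin> ?B1" "y \<notin> ?B1" for x y
      using \<phi>f[of x y] that by (simp add: m)
  qed
  have M2: "finite (?s ` ?M2)"
  proof (rule finite_classes_missed[OF darkS s comp_elt[OF \<phi>(1) g(1)] B2])
    show "?s (elt (\<phi> (g x))) = ?s (elt (\<phi> (g y))) \<longleftrightarrow> ?s x = ?s y"
      if "x \<notin> ?B2" "y \<notin> ?B2" for x y
      using \<phi>g[of x y] that by (simp add: m)
  qed
  \<comment> \<open>The exceptions for \<open>h\<close> are translated into indices in the matched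
    sum, so that one number \<open>n\<close> can avoid all four finite sets.\<close>
  have "finite ((\<lambda>x. ?m (\<phi> (f x))) ` ?H1)"
    by (rule finite_image_factor[OF H1]) (simp add: \<phi>f)
  moreover have "finite ((\<lambda>x. ?m (\<phi> (g x))) ` ?H2)"
    by (rule finite_image_factor[OF H2]) (simp add: \<phi>g)
  ultimately have fin: "finite (?r ` ?M1 \<union> ?s ` ?M2 \<union>
      (\<lambda>x. ?m (\<phi> (f x))) ` ?H1 \<union> (\<lambda>x. ?m (\<phi> (g x))) ` ?H2)"
    using M1 M2 by blast
  obtain n where n: "n \<notin> ?r ` ?M1" "n \<notin> ?s ` ?M2"
    "n \<notin> (\<lambda>x. ?m (\<phi> (f x))) ` ?H1" "n \<notin> (\<lambda>x. ?m (\<phi> (g x))) ` ?H2"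
    using ex_new_if_finite[OF infinite_UNIV_nat fin] unfolding Un_iff de_Morgan_disj
    by (elim exE conjE) (rule that)
  \<comment> \<open>Darkness includes having infinitely many classes, so \<open>n\<close> numbers a
    class of \<open>R\<close> as well as a class of \<open>S\<close>; the two are glued.\<close>
  have "surj ?r" "surj ?s"
    using surj_class_index[OF R] surj_class_index[OF S] darkR darkS by (simp_all add: dark_def)
  then obtain a b where a: "n = ?r a" and b: "n = ?s b"
    by (meson surjD)
  from a n(1) obtain x where "side (\<phi> (f x)) = 0" "?r (elt (\<phi> (f x))) = n"
    by blast
  then have x: "?m (\<phi> (f x)) = n"
    by (simp add: m)
  from b n(2) obtain y where "side (\<phi> (g y)) \<noteq> 0" "?s (elt (\<phi> (g y))) = n"
    by blast
  then have y: "?m (\<phi> (g y)) = n"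
    by (simp add: m)
  \<comment> \<open>The equal matched indices make \<open>f x\<close> and \<open>g y\<close>
    equivalent in \<open>T\<close>, and \<open>h\<close> must respect this.\<close>
  from x y have "?d (h (f x)) = ?d (h (g y))"
    using \<phi>(2)[of "f x" "g y"] h(2)[of "f x" "g y"] by simp
  \<comment> \<open>Otherwise \<open>x\<close> would belong to \<open>?H1\<close>, and
    \<open>n\<close> would be one of the excluded indices.\<close>
  moreover have "side (h (f x)) = 0"
    using n(3) x by (auto simp: image_iff)
  moreover have "side (h (g y)) \<noteq> 0"
    using n(4) y by (auto simp: image_iff)
  ultimately show False
    using d by simp
qed

end
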